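(* Let $f\colon \mathbb{S}^{n\times n}\to\mathbb{R}$ be linear and fix $p>p^*$ (hence $\Delta>0$). If $Y\in\mathrm{St}(d,p)^m$ is a second-order critical point of $(\mathrm{RP}_p)$ but $X=YY^\top$ is not a global optimizer of $(\mathrm{P})$, then $\operatorname{rank}(X)=p$, $\dim\mathcal{F}_X\ge\Delta+p$, and $f$ is constant over $\mathcal{F}_X$.
   Context: Integers satisfy $m\ge 1$, $1\le d\le p\le n=md$. $\mathbb{S}^{k\times k}$ is the space of real symmetric $k\times k$ matrices. Matrices $M\in\mathbb{R}^{n\times n}$ are viewed as $m\times m$ block matrices with blocks $M_{ij}\in\mathbb{R}^{d\times d}$; $Y\in\mathbb{R}^{n\times p}$ is viewed as a stack of slices $Y_1,\dots,Y_m\in\mathbb{R}^{d\times p}$. Inner product: $\langle A,B\rangle=\operatorname{trace}(A^\top B)$. $\nabla f(X)\in\mathbb{S}^{n\times n}$ and $\nabla^2 f(X)$ are the Euclidean gradient and Hessian operator of $f$ on $\mathbb{S}^{n\times n}$. Define $\mathrm{St}(d,p)^m=\{Y\in\mathbb{R}^{n\times p}: Y_iY_i^\top=I_d,\ i=1,\dots,m\}$ and $\mathcal{C}=\{X\in\mathbb{S}^{n\times n}: X\succeq 0,\ X_{ii}=I_d,\ i=1,\dots,m\}$. Problem $(\mathrm{P})$: minimize $f(X)$ over $X\in\mathcal{C}$. Problem $(\mathrm{RP}_p)$: minimize $g(Y)=f(YY^\top)$ over $Y\in\mathrm{St}(d,p)^m$. $\operatorname{symblockdiag}(M)$ is the matrix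 with diagonal blocks $(M_{ii}+M_{ii}^\top)/2$ and all other blocks zero. The tangent space is $\mathrm{T}_Y\mathrm{St}(d,p)^m=\{\dot Y\in\mathbb{R}^{n\times p}:\operatorname{symblockdiag}(\dot YY^\top+Y\dot Y^\top)=0\}$. With $X=YY^\top$, $Y\in\mathrm{St}(d,p)^m$ is a critical point of $(\mathrm{RP}_p)$ if the Riemannian gradient of $g$ vanishes, i.e. $(\nabla f(X)-\operatorname{symblockdiag}(\nabla f(X)X))Y=0$. It is a second-order critical point if moreover the Riemannian Hessian is positive semidefinite, i.e. $\langle\dot Y,\nabla^2 g(Y)[\dot Y]-\operatorname{symblockdiag}(\nabla g(Y)Y^\top)\dot Y\rangle\ge 0$ for all $\dot Y\in\mathrm{T}_Y\mathrm{St}(d,p)^m$, where $\nabla g(Y)=2\nabla f(X)Y$ and $\nabla^2g(Y)[\dot Y]=2(\nabla^2f(X)[\dot X]Y+\nabla f(X)\dot Y)$ with $\dot X=\dot YY^\top+Y\dot Y^\top$. A face of $\mathcal{C}$ is a convex subset $\mathcal{F}\subseteq\mathcal{C}$ such that every closed line segment in $\mathcal{C}$ with a relative interior point in $\mathcal{F}$ has both endpoints in $\mathcal{F}$. For $X\in\mathcal{C}$, $\mathcal{F}_X$ is the unique face of $\mathcal{C}$ containing $X$ in its relative interior. Explicitly, if $X=ZZ^\top$ with $Z\in\mathbb{R}^{n\times r}$, $r=\operatorname{rank}(X)$, then $\mathcal{F}_X=\{Z(I_r+A)Z^\top: A\in\mathbb{S}^{r\times r},\ Z_iAZ_i^\top=0\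 (i=1,\dots,m),\ I_r+A\succeq 0\}$, and $\dim\mathcal{F}_X=\dim\{A\in\mathbb{S}^{r\times r}: Z_iAZ_i^\top=0,\ i=1,\dots,m\}$. $\Delta=\dfrac{p(p+1)}{2}-m\dfrac{d(d+1)}{2}$ and $p^*=\dfrac{\sqrt{1+4md(d+1)}-1}{2}$. *)

theory Defs
  imports "HOL-Analysis.Analysis"
begin

text \<open>
  The sizes are carried by finite index types: \<open>m = CARD('m)\<close>, \<open>d = CARD('d)\<close>, \<open>p = CARD('p)\<close>.
  A row index of an \<open>n\<close>-row matrix is a pair (block, position in the block), so \<open>n = md\<close> is the
  cardinality of \<open>'m \<times> 'd\<close>.
\<close>

type_synonym ('m, 'd) blockmat = "real^('m \<times> 'd)^('m \<times> 'd)"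
type_synonym ('m, 'd, 'p) slicemat = "real^'p^('m \<times> 'd)"

definition block :: "('m::finite, 'd::finite) blockmat \<Rightarrow> 'm \<Rightarrow> 'm \<Rightarrow> real^'d^'d" where
  "block M i j = (\<chi> a b. M $ (i, a) $ (j, b))"

definition slice :: "('m::finite, 'd::finite, 'p::finite) slicemat \<Rightarrow> 'm \<Rightarrow> real^'p^'d" where
  "slice Y i = (\<chi> a. Y $ (i, a))"

definition frob :: "real^'b^'a \<Rightarrow> real^'b^'a \<Rightarrow> real" where
  "frob A B = trace (transpose A ** B)"

definition symm :: "(real^'n^'n) set" where
  "symm = {X. transpose X = X}"

definition psd :: "real^'n^'n \<Rightarrow> bool" where
  "psd X \<longleftrightarrow> X \<in> symm \<and> (\<forall>v. 0 \<le> v \<bullet> (X *v v))"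

definition stiefel :: "('m::finite, 'd::finite, 'p::finite) slicemat set" where
  "stiefel = {Y. \<forall>i. slice Y i ** transpose (slice Y i) = mat 1}"

definition feasible :: "('m::finite, 'd::finite) blockmat set" where
  "feasible = {X. psd X \<and> (\<forall>i. block X i i = mat 1)}"

definition global_optimizer :: "(('m::finite, 'd::finite) blockmat \<Rightarrow> real) \<Rightarrow> ('m, 'd) blockmat \<Rightarrow> bool" where
  "global_optimizer f X \<longleftrightarrow> X \<in> feasible \<and> (\<forall>X'\<in>feasible. f X \<le> f X')"

text \<open>
  A function on the symmetric matrices is represented by a total function of which only the
  values on \<^const>\<open>symm\<close> are ever used. Accordingly linearity is required on \<^const>\<open>symm\<close> only, and
  derivatives are taken within \<^const>\<open>symm\<close>.
\<close>

definition linear_on_symm :: "(real^'n^'n \<Rightarrow> real) \<Rightarrow> bool" where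
  "linear_on_symm f \<longleftrightarrow>
     (\<forall>X\<in>symm. \<forall>Z\<in>symm. f (X + Z) = f X + f Z) \<and>
     (\<forall>c. \<forall>X\<in>symm. f (c *\<^sub>R X) = c * f X)"

definition grad :: "(real^'n^'n \<Rightarrow> real) \<Rightarrow> real^'n^'n \<Rightarrow> real^'n^'n" where
  "grad f X = (THE G. G \<in> symm \<and> (f has_derivative frob G) (at X within symm))"

text \<open>\<open>hess f X V\<close> is \<open>\<nabla>\<^sup>2f(X)[V]\<close>; it is meaningful for symmetric \<open>X\<close> and \<open>V\<close>.\<close>

definition hess :: "(real^'n^'n \<Rightarrow> real) \<Rightarrow> real^'n^'n \<Rightarrow> real^'n^'n \<Rightarrow> real^'n^'n" where
  "hess f X = frechet_derivative (grad f) (at X within symm)"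

definition symblockdiag :: "('m::finite, 'd::finite) blockmat \<Rightarrow> ('m, 'd) blockmat" where
  "symblockdiag M = (\<chi> r s. if fst r = fst s
     then ((1/2) *\<^sub>R (block M (fst r) (fst r) + transpose (block M (fst r) (fst r)))) $ snd r $ snd s
     else 0)"

definition tangent :: "('m::finite, 'd::finite, 'p::finite) slicemat \<Rightarrow> ('m, 'd, 'p) slicemat set" where
  "tangent Y = {V. symblockdiag (V ** transpose Y + Y ** transpose V) = 0}"

text \<open>Euclidean gradient and Hessian of \<open>g(Y) = f(YY\<^sup>T)\<close>, in terms of those of \<open>f\<close>.\<close>

definition grad_g :: "(('m::finite, 'd::finite) blockmat \<Rightarrow> real)
    \<Rightarrow> ('m, 'd, 'p::finite) slicemat \<Rightarrow> ('m, 'd, 'p) slicemat" where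
  "grad_g f Y = 2 *\<^sub>R (grad f (Y ** transpose Y) ** Y)"

definition hess_g :: "(('m::finite, 'd::finite) blockmat \<Rightarrow> real)
    \<Rightarrow> ('m, 'd, 'p::finite) slicemat \<Rightarrow> ('m, 'd, 'p) slicemat \<Rightarrow> ('m, 'd, 'p) slicemat" where
  "hess_g f Y V = 2 *\<^sub>R
     (hess f (Y ** transpose Y) (V ** transpose Y + Y ** transpose V) ** Y
      + grad f (Y ** transpose Y) ** V)"

definition critical_point :: "(('m::finite, 'd::finite) blockmat \<Rightarrow> real)
    \<Rightarrow> ('m, 'd, 'p::finite) slicemat \<Rightarrow> bool" where
  "critical_point f Y \<longleftrightarrow> Y \<in> stiefel \<and>
     (let X = Y ** transpose Y in (grad f X - symblockdiag (grad f X ** X)) ** Y = 0)"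

definition second_order_critical_point :: "(('m::finite, 'd::finite) blockmat \<Rightarrow> real)
    \<Rightarrow> ('m, 'd, 'p::finite) slicemat \<Rightarrow> bool" where
  "second_order_critical_point f Y \<longleftrightarrow> critical_point f Y \<and>
     (\<forall>V\<in>tangent Y. 0 \<le> frob V (hess_g f Y V - symblockdiag (grad_g f Y ** transpose Y) ** V))"

definition face_at :: "('m::finite, 'd::finite) blockmat \<Rightarrow> ('m, 'd) blockmat set" where
  "face_at X = (THE F. F face_of feasible \<and> X \<in> rel_interior F)"

definition Delta :: "nat \<Rightarrow> nat \<Rightarrow> nat \<Rightarrow> real" where
  "Delta m d p = real p * (real p + 1) / 2 - real m * (real d * (real d + 1) / 2)"

definition pstar :: "nat \<Rightarrow> nat \<Rightarrow> real" where
  "pstar m d = (sqrt (1 + 4 * real m * real d * (real d + 1)) - 1) / 2"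

lemma Delta_pos: "0 < Delta m d p" if "pstar m d < real p"
proof -
  have "sqrt (1 + 4 * real m * real d * (real d + 1)) < 2 * real p + 1"
    using that by (simp add: pstar_def)
  then have "1 + 4 * real m * real d * (real d + 1) < (2 * real p + 1)\<^sup>2"
    by (smt (verit) of_nat_0_le_iff real_le_lsqrt real_sqrt_le_iff real_sqrt_unique)
  then show ?thesis
    by (simp add: Delta_def power2_eq_square algebra_simps)
qed

lemma frob_eq_inner: "frob A B = A \<bullet> B"
proof -
  have "frob A B = (\<Sum>j\<in>UNIV. \<Sum>i\<in>UNIV. A $ i $ j * B $ i $ j)"
    by (simp add: frob_def trace_def matrix_matrix_mult_def transpose_def)
  also have "\<dots> = (\<Sum>i\<in>UNIV. \<Sum>j\<in>UNIV. A $ i $ j * B $ i $ j)"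
    by (rule sum.swap)
  finally show ?thesis
    by (simp add: inner_vec_def)
qed

lemma subspace_symm: "subspace symm"
  by (auto simp: subspace_def symm_def transpose_def vec_eq_iff)

lemma has_derivative_within_subspace_unique:
  fixes f :: "'a::real_normed_vector \<Rightarrow> 'b::real_normed_vector"
  assumes S: "subspace S" and x: "x \<in> S" and v: "v \<in> S"
    and f1: "(f has_derivative f1) (at x within S)"
    and f2: "(f has_derivative f2) (at x within S)"
  shows "f1 v = f2 v"
proof -
  have *: "((\<lambda>t. f (x + t *\<^sub>R v)) has_vector_derivative f' v) (at 0)"
    if f': "(f has_derivative f') (at x within S)" for f'
  proof -
    have img: "range (\<lambda>t. x + t *\<^sub>R v) \<subseteq> S"
      using S x v by (auto simp: subspace_add subspace_scale)
    have "((\<lambda>t. x + t *\<^sub>R v) has_derivative (\<lambda>t. t *\<^sub>R v)) (at 0)"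
      by (auto intro!: derivative_eq_intros)
    moreover have "(f has_derivative f') (at (x + 0 *\<^sub>R v) within range (\<lambda>t. x + t *\<^sub>R v))"
      using has_derivative_subset[OF f' img] by simp
    ultimately have "((\<lambda>t. f (x + t *\<^sub>R v)) has_derivative (\<lambda>t. f' (t *\<^sub>R v))) (at 0)"
      by (rule has_derivative_in_compose)
    then show ?thesis
      using has_derivative_linear[OF f'] by (simp add: has_vector_derivative_def linear_scale)
  qed
  show ?thesis
    using *[OF f1] *[OF f2] by (rule vector_derivative_unique_at)
qed

lemma grad_eqI:
  assumes X: "X \<in> symm" and G: "G \<in> symm" and df: "(f has_derivative frob G) (at X within symm)"
  shows "grad f X = G"
  unfolding grad_def
proof (rule the_equality)
  fix G' assume G': "G' \<in> symm \<and> (f has_derivative frob G') (at X within symm)"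
  have "G' - G \<in> symm"
    using G G' subspace_symm subspace_diff by blast
  then have "frob G' (G' - G) = frob G (G' - G)"
    using has_derivative_within_subspace_unique[OF subspace_symm X] df G' by blast
  then have "(G' - G) \<bullet> (G' - G) = 0"
    by (simp add: frob_eq_inner inner_diff_left)
  then show "G' = G"
    by simp
qed (use G df in blast)

lemma linear_on_symm_grad:
  fixes f :: "real^'n^'n \<Rightarrow> real"
  assumes "linear_on_symm f"
  obtains G where "G \<in> symm" "\<And>X. X \<in> symm \<Longrightarrow> f X = frob G X" "\<And>X. X \<in> symm \<Longrightarrow> grad f X = G"
proof -
  define s :: "real^'n^'n \<Rightarrow> real^'n^'n" where "s = (\<lambda>X. (1/2) *\<^sub>R (X + transpose X))"
  have s_lin: "linear s"
    by (rule linearI) (auto simp: s_def transpose_def vec_eq_iff algebra_simps)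
  have s_symm: "s X \<in> symm" for X
    by (auto simp: s_def symm_def transpose_def vec_eq_iff algebra_simps)
  have s_id: "s X = X" if "X \<in> symm" for X
    using that by (auto simp: s_def symm_def scaleR_2[symmetric])
  have "linear (\<lambda>X. f (s X))"
    using assms s_symm
    by (intro linearI) (auto simp: linear_on_symm_def linear_add[OF s_lin] linear_scale[OF s_lin])
  then have G0: "f (s X) = adjoint (\<lambda>X. f (s X)) 1 \<bullet> X" for X
    using adjoint_works[of "\<lambda>X. f (s X)" X 1] by (simp add: inner_commute)
  define G where "G = s (adjoint (\<lambda>X. f (s X)) 1)"
  have s_adj: "s A \<bullet> B = A \<bullet> s B" for A B
  proof -
    have "transpose A \<bullet> B = A \<bullet> transpose B"
      by (simp add: inner_vec_def transpose_def) (rule sum.swap)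
    then show ?thesis
      by (simp add: s_def inner_add_left inner_add_right)
  qed
  have Gs: "G \<in> symm"
    unfolding G_def by (rule s_symm)
  have fG: "f X = frob G X" if "X \<in> symm" for X
    unfolding G_def frob_eq_inner s_adj using G0[of X] by (simp only: s_id[OF that])
  have "grad f X = G" if X: "X \<in> symm" for X
  proof (rule grad_eqI[OF X])
    show "G \<in> symm"
      by (rule Gs)
    have "(frob G has_derivative frob G) (at X within symm)"
      by (simp add: frob_eq_inner[abs_def] bounded_linear_imp_has_derivative bounded_linear_inner_right)
    then show "(f has_derivative frob G) (at X within symm)"
      using has_derivative_transform[OF X, of f "frob G"] fG by blast
  qed
  then show thesis
    using that[of G] fG Gs by blast
qed

lemma linear_on_symm_hess:
  assumes f: "linear_on_symm f" and X: "X \<in> symm" and V: "V \<in> symm"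
  shows "hess f X V = 0"
proof -
  obtain G where G: "\<And>Z. Z \<in> symm \<Longrightarrow> grad f Z = G"
    using linear_on_symm_grad[OF f] by metis
  have d: "(grad f has_derivative (\<lambda>_. 0)) (at X within symm)"
    using has_derivative_transform[OF X, of "grad f" "\<lambda>_. G"] G by simp
  then have "(grad f has_derivative hess f X) (at X within symm)"
    unfolding hess_def using differentiableI frechet_derivative_works by blast
  then show ?thesis
    using has_derivative_within_subspace_unique[OF subspace_symm X V _ d] by blast
qed

end

theory Submission
  imports Defs
begin

text \<open>
  Let \<open>C\<close> be the constant gradient of \<open>f\<close> and \<open>S = C - symblockdiag (C X)\<close>. Criticality says
  \<open>S Y = 0\<close>, and since \<open>f\<close> and \<open>S\<close> induce the same differences on the feasible set, \<open>X\<close> would be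
  optimal if \<open>S\<close> were positive semidefinite. So there is \<open>u\<close> with \<open>u\<^sup>T S u < 0\<close>. As \<open>S Y = 0\<close>, the
  second-order form takes the value \<open>|z|\<^sup>2 u\<^sup>T S u\<close> at \<open>u z\<^sup>T + Y A\<close>, so such a matrix is tangent only
  if \<open>z = 0\<close>. With \<open>A = 0\<close> and \<open>Y z = 0\<close> this gives full column rank of \<open>Y\<close>. In general it says that the
  linear map from pairs \<open>(z, A)\<close>, \<open>A\<close> symmetric, to the \<open>m d (d + 1) / 2\<close> tangency constraints has its
  kernel inside \<open>z = 0\<close>, where it consists of the directions \<open>A\<close> of the face; counting dimensions
  gives the lower bound. Finally, \<open>f\<close> varies on the face by the inner product of \<open>S\<close> with matrices
  \<open>Y B Y\<^sup>T\<close>, which is zero.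
\<close>

section \<open>Dimension counts for subspaces, symmetric matrices and diagonal blocks\<close>

text \<open>\<open>f\<close> is injective on the orthogonal complement \<open>T\<close> of its
  kernel \<open>K\<close> inside \<open>S\<close>, so \<open>dim T\<close> is at most the dimension
  of the image, and \<open>dim S\<close> is \<open>dim T\<close> plus \<open>dim K\<close>.\<close>

lemma dim_le_dim_image_plus_kernel:
  fixes f :: "'a::euclidean_space \<Rightarrow> 'b::euclidean_space"
  assumes f: "linear f" and S: "subspace S"
  shows "dim S \<le> dim (f ` S) + dim {x \<in> S. f x = 0}"
proof -
  define K where "K = {x \<in> S. f x = 0}"
  define T where "T = {y \<in> S. \<forall>x \<in> K. orthogonal x y}"
  have K: "subspace K"
    using S subspace_inter[OF S linear_subspace_kernel[OF f]] by (simp add: K_def Int_def)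
  have T: "subspace T"
    unfolding T_def using S
    by (auto simp: subspace_def orthogonal_def inner_add_right)
  have span: "span T = T"
    using T by simp
  have "inj_on f T"
  proof (rule inj_onI)
    fix x y assume "x \<in> T" "y \<in> T" and eq: "f x = f y"
    from this(1,2) have xy: "x - y \<in> T"
      by (rule subspace_diff[OF T])
    with eq have "x - y \<in> K"
      by (simp add: K_def T_def linear_diff[OF f])
    with xy show "x = y"
      by (auto simp: T_def orthogonal_def)
  qed
  then have "dim T = dim (f ` T)"
    by (rule dim_image_eq[OF f, of T, unfolded span, symmetric])
  also have "\<dots> \<le> dim (f ` S)"
    by (rule dim_subset) (auto simp: T_def)
  finally show ?thesis
    using dim_subspace_orthogonal_to_vectors[OF K S] by (auto simp: T_def K_def)
qed

text \<open>Pairing \<open>x\<close> with \<open>\<Sum>b\<in>d. (x \<bullet> b) *\<^sub>R b\<close>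
  gives a sum of squares, so this map has trivial kernel on \<open>S\<close>, while its image lies
  in \<open>span d\<close>.\<close>

lemma dim_le_card_coordinates:
  fixes S :: "'a::euclidean_space set"
  assumes S: "subspace S" and d: "finite d"
    and 0: "\<And>x. x \<in> S \<Longrightarrow> (\<And>b. b \<in> d \<Longrightarrow> x \<bullet> b = 0) \<Longrightarrow> x = 0"
  shows "dim S \<le> card d"
proof -
  define f where "f = (\<lambda>x. \<Sum>b\<in>d. (x \<bullet> b) *\<^sub>R b)"
  have f: "linear f"
    unfolding f_def by (intro linear_compose_sum ballI linearI) (auto simp: inner_add_left scaleR_add_left)
  have "{x \<in> S. f x = 0} \<subseteq> {0}"
  proof safe
    fix x assume x: "x \<in> S" "f x = 0"
    have "(\<Sum>b\<in>d. (x \<bullet> b)\<^sup>2) = x \<bullet> f x"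
      by (simp add: f_def inner_sum_right power2_eq_square)
    also have "\<dots> = 0" using x by simp
    finally have "\<forall>b\<in>d. (x \<bullet> b)\<^sup>2 = 0"
      using d by (subst (asm) sum_nonneg_eq_0_iff) auto
    then show "x = 0" using 0 x by simp
  qed
  then have "dim {x \<in> S. f x = 0} = 0"
    by (simp add: dim_eq_0)
  moreover have "f ` S \<subseteq> span d"
    unfolding f_def by (blast intro: span_sum span_scale span_base)
  then have "dim (f ` S) \<le> card d"
    using d by (rule dim_le_card)
  ultimately show ?thesis
    using dim_le_dim_image_plus_kernel[OF f S] by linarith
qed

text \<open>\<open>T\<close> plays the role of an upper triangle with its diagonal; the order on the
  indices is borrowed from an injection into the naturals.\<close>

lemma exists_ordered_pairs:
  obtains T :: "('n::finite \<times> 'n) set"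
  where "2 * card T = CARD('n) * (CARD('n) + 1)" "\<And>i j. (i, j) \<in> T \<or> (j, i) \<in> T"
    "\<And>i j. (i, j) \<in> T \<Longrightarrow> (j, i) \<in> T \<Longrightarrow> i = j"
proof -
  obtain h :: "'n \<Rightarrow> nat" where h: "inj h"
    using finite_imp_inj_to_nat_seg[of "UNIV :: 'n set"] by auto
  define T where "T = {(i, j). h i \<le> h j}"
  have card: "card T + card (T\<inverse>) = card (UNIV :: ('n \<times> 'n) set) + card (Id :: ('n \<times> 'n) set)"
  proof -
    have "T \<union> T\<inverse> = UNIV" "T \<inter> T\<inverse> = Id"
      using h by (auto simp: T_def inj_def)
    then show ?thesis
      using card_Un_Int[of T "T\<inverse>"] by simp
  qed
  have "(Id :: ('n \<times> 'n) set) = (\<lambda>i. (i, i)) ` UNIV"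
    by auto
  moreover have "card ((\<lambda>i :: 'n. (i, i)) ` UNIV) = CARD('n)"
    by (rule card_image) (simp add: inj_on_def)
  ultimately have "card (Id :: ('n \<times> 'n) set) = CARD('n)"
    by simp
  with card have "2 * card T = CARD('n) * (CARD('n) + 1)"
    by (simp add: card_inverse)
  then show thesis
    using h by (intro that[of T]) (auto simp: T_def inj_def)
qed

text \<open>Symmetric matrices are the kernel of \<open>A - transpose A\<close>. The image of that
  map is skew, hence determined by the entries outside \<open>T\<close>, which leaves at least
  \<open>card T\<close> dimensions for the kernel.\<close>

lemma dim_symm_ge: "CARD('n) * (CARD('n) + 1) \<le> 2 * dim (symm :: (real^'n::finite^'n) set)"
proof -
  obtain T :: "('n \<times> 'n) set"
    where T: "2 * card T = CARD('n) * (CARD('n) + 1)" "\<And>i j. (i, j) \<in> T \<or> (j, i) \<in> T"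
      "\<And>i j. (i, j) \<in> T \<Longrightarrow> (j, i) \<in> T \<Longrightarrow> i = j"
    by (rule exists_ordered_pairs) blast
  define d :: "(real^'n^'n) set" where "d = (\<lambda>(i, j). axis i (axis j 1)) ` (- T)"
  have "dim (UNIV :: (real^'n^'n) set) \<le> dim ((\<lambda>A. A - transpose A) ` (UNIV :: (real^'n^'n) set))
      + dim {A \<in> (UNIV :: (real^'n^'n) set). A - transpose A = 0}"
    by (intro dim_le_dim_image_plus_kernel linearI)
      (auto simp: transpose_def vec_eq_iff algebra_simps)
  also have "{A \<in> (UNIV :: (real^'n^'n) set). A - transpose A = 0} = symm"
    by (auto simp: symm_def)
  also have "dim ((\<lambda>A. A - transpose A) ` (UNIV :: (real^'n^'n) set)) \<le> card d"
  proof (rule dim_le_card_coordinates)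
    show "subspace ((\<lambda>A. A - transpose A) ` (UNIV :: (real^'n^'n) set))"
      by (intro linear_subspace_image linearI) (auto simp: transpose_def vec_eq_iff algebra_simps)
    fix M :: "real^'n^'n" assume "M \<in> range (\<lambda>A. A - transpose A)" and *: "\<And>b. b \<in> d \<Longrightarrow> M \<bullet> b = 0"
    then have skew: "M $ i $ j = - M $ j $ i" for i j
      by (auto simp: transpose_def)
    have 0: "M $ i $ j = 0" if "(i, j) \<notin> T" for i j
    proof -
      have "axis i (axis j 1) \<in> d" using that by (force simp: d_def)
      from *[OF this] show ?thesis by (simp add: inner_axis)
    qed
    \<comment> \<open>If both orders of the pair lie in \<open>T\<close>, the entry is diagonal and
      skewness makes it its own negative.\<close>
    have "M $ i $ j = 0" for i j
      using 0[of i j] 0[of j i] skew[of i j] T(3)[of i j] by fastforce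
    then show "M = 0"
      by (simp add: vec_eq_iff)
  qed (simp add: d_def)
  also have "card d \<le> card (- T)"
    unfolding d_def by (rule card_image_le) simp
  also have "card (- T) = CARD('n) * CARD('n) - card T"
    by (simp add: Compl_eq_Diff_UNIV card_Diff_subset)
  finally have "CARD('n) * CARD('n) \<le> CARD('n) * CARD('n) - card T + dim (symm :: (real^'n^'n) set)"
    by simp
  moreover have "card T \<le> CARD('n) * CARD('n)"
    using card_mono[of UNIV T] by simp
  ultimately have "card T \<le> dim (symm :: (real^'n^'n) set)"
    by simp
  then show ?thesis
    using T(1) by simp
qed

lemma linear_symblockdiag: "linear symblockdiag"
  by (rule linearI) (auto simp: symblockdiag_def block_def transpose_def vec_eq_iff algebra_simps)

lemma symblockdiag_nth:
  "symblockdiag M $ (i, a) $ (j, b) =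
    (if i = j then (M $ (i, a) $ (i, b) + M $ (i, b) $ (i, a)) / 2 else 0)"
  by (simp add: symblockdiag_def block_def transpose_def)

text \<open>This bounds the number of independent tangency constraints: a matrix in the range is
  block diagonal and symmetric, so the triangle \<open>T\<close> of each diagonal block determines
  it.\<close>

lemma dim_symblockdiag_le:
  "2 * dim (range (symblockdiag :: ('m::finite, 'd::finite) blockmat \<Rightarrow> _))
    \<le> CARD('m) * (CARD('d) * (CARD('d) + 1))"
proof -
  obtain T :: "('d \<times> 'd) set"
    where T: "2 * card T = CARD('d) * (CARD('d) + 1)" "\<And>a b. (a, b) \<in> T \<or> (b, a) \<in> T"
    by (rule exists_ordered_pairs) blast
  define D :: "('m, 'd) blockmat set"
    where "D = (\<lambda>(i, a, b). axis (i, a) (axis (i, b) 1)) ` (UNIV \<times> T)"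
  have "dim (range (symblockdiag :: ('m, 'd) blockmat \<Rightarrow> _)) \<le> card D"
  proof (rule dim_le_card_coordinates)
    show "subspace (range (symblockdiag :: ('m, 'd) blockmat \<Rightarrow> _))"
      by (intro linear_subspace_image linear_symblockdiag subspace_UNIV)
    fix M :: "('m, 'd) blockmat"
    assume M: "M \<in> range symblockdiag" and *: "\<And>b. b \<in> D \<Longrightarrow> M \<bullet> b = 0"
    have "M $ (i, a) $ (i, b) = 0" if "(a, b) \<in> T" for i a b
    proof -
      have "axis (i, a) (axis (i, b) 1) \<in> D" using that by (force simp: D_def)
      from *[OF this] show ?thesis by (simp add: inner_axis)
    qed
    moreover have "M $ (i, a) $ (i, b) = M $ (i, b) $ (i, a)" for i a b
      using M by (auto simp: symblockdiag_nth)
    moreover have "M $ (i, a) $ (j, b) = 0" if "i \<noteq> j" for i j a b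
      using M that by (auto simp: symblockdiag_nth)
    ultimately have "M $ (i, a) $ (j, b) = 0" for i j a b
      using T(2) by metis
    then show "M = 0"
      by (simp add: vec_eq_iff)
  qed (simp add: D_def)
  also have "card D \<le> card ((UNIV :: 'm set) \<times> T)"
    unfolding D_def by (rule card_image_le) simp
  also have "\<dots> = CARD('m) * card T"
    by (simp add: card_cartesian_product)
  finally show ?thesis
    unfolding T(1)[symmetric] by simp
qed

section \<open>Positive semidefinite matrices and their inner products\<close>

lemma inner_matrix_mult_left:
  fixes A :: "real^'c^'a"
  shows "(B ** C) \<bullet> A = C \<bullet> (transpose B ** A)"
  unfolding frob_eq_inner[symmetric] frob_def matrix_transpose_mul matrix_mul_assoc ..

lemma psd_iff: "psd Z \<longleftrightarrow> transpose Z = Z \<and> (\<forall>v. 0 \<le> v \<bullet> (Z *v v))"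
  by (simp add: psd_def symm_def)

lemma symm_inner_commute:
  assumes "X \<in> symm"
  shows "u \<bullet> (X *v v) = v \<bullet> (X *v u)"
proof -
  have "u v* X = X *v u"
    using assms by (simp add: symm_def flip: transpose_matrix_vector)
  then show ?thesis
    by (metis dot_lmul_matrix inner_commute)
qed

text \<open>The form at \<open>u + t *\<^sub>R v\<close> is a quadratic in \<open>t\<close> that is
  never negative; the inequality is the sign of its discriminant.\<close>

lemma psd_cauchy_schwarz:
  assumes "psd Z"
  shows "(u \<bullet> (Z *v v))\<^sup>2 \<le> (u \<bullet> (Z *v u)) * (v \<bullet> (Z *v v))"
proof -
  define a b c where "a = u \<bullet> (Z *v u)" and "b = u \<bullet> (Z *v v)" and "c = v \<bullet> (Z *v v)"
  have Z: "Z \<in> symm" and nn: "\<And>w. 0 \<le> w \<bullet> (Z *v w)"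
    using assms by (auto simp: psd_def)
  have q: "0 \<le> a + 2 * t * b + t\<^sup>2 * c" for t
  proof -
    have "v \<bullet> (Z *v u) = b"
      unfolding b_def by (rule symm_inner_commute[OF Z])
    then have "(u + t *\<^sub>R v) \<bullet> (Z *v (u + t *\<^sub>R v)) = a + 2 * t * b + t\<^sup>2 * c"
      by (simp add: a_def b_def[symmetric] c_def matrix_vector_right_distrib matrix_vector_mult_scaleR
          inner_add_left inner_add_right power2_eq_square ring_distribs)
    with nn[of "u + t *\<^sub>R v"] show ?thesis by simp
  qed
  have "b\<^sup>2 \<le> a * c"
  proof (cases "c = 0")
    case True
    have "b = 0"
    proof (rule ccontr)
      assume "b \<noteq> 0"
      \<comment> \<open>With \<open>c = 0\<close> the quadratic is affine in \<open>t\<close>, and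
        this choice of \<open>t\<close> gives it the value -1.\<close>
      then have "2 * (- (a + 1) / (2 * b)) * b = - (a + 1)"
        by (simp add: field_simps)
      with True q[of "- (a + 1) / (2 * b)"] show False by simp
    qed
    with True show ?thesis by simp
  next
    case False
    then have c: "0 < c"
      using nn[of v] by (simp add: c_def)
    \<comment> \<open>The quadratic is minimal at \<open>t = - b / c\<close>; the factor
      \<open>c\<close> clears the denominators.\<close>
    have "0 \<le> c * (a + 2 * (- b / c) * b + (- b / c)\<^sup>2 * c)"
      using q[of "- b / c"] c by (intro mult_nonneg_nonneg) auto
    also have "\<dots> = a * c - b\<^sup>2"
      using c by (simp add: field_simps power2_eq_square)
    finally show ?thesis by simp
  qed
  then show ?thesis
    by (simp add: a_def b_def c_def)
qed

text \<open>Cauchy-Schwarz with \<open>u = Z *v v\<close> bounds the fourth power of the norm of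
  \<open>Z *v v\<close> by 0.\<close>

lemma psd_mult_eq_0:
  assumes "psd Z" and "v \<bullet> (Z *v v) = 0"
  shows "Z *v v = 0"
  using psd_cauchy_schwarz[OF assms(1), of "Z *v v" v] assms(2) by simp

definition outer :: "real^'a \<Rightarrow> real^'b \<Rightarrow> real^'b^'a" where
  "outer u v = (\<chi> i j. u $ i * v $ j)"

lemma outer_mult_vec: "outer u v *v w = (v \<bullet> w) *\<^sub>R u"
  by (simp add: outer_def matrix_vector_mult_def vec_eq_iff inner_vec_def sum_distrib_left mult_ac)

lemma mult_outer: "A ** outer u v = outer (A *v u) v"
  by (simp add: outer_def matrix_matrix_mult_def matrix_vector_mult_def vec_eq_iff
      sum_distrib_left mult_ac)

lemma outer_mult: "outer u v ** A = outer u (transpose A *v v)"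
  by (simp add: outer_def matrix_matrix_mult_def matrix_vector_mult_def transpose_def vec_eq_iff
      sum_distrib_left mult_ac)

lemma inner_outer: "A \<bullet> outer u v = u \<bullet> (A *v v)"
  by (simp add: outer_def matrix_vector_mult_def inner_vec_def sum_distrib_left mult_ac)

lemma outer_0_left [simp]: "outer 0 v = 0"
  by (simp add: outer_def vec_eq_iff)

lemma transpose_outer: "transpose (outer u v) = outer v u"
  by (simp add: outer_def transpose_def vec_eq_iff mult.commute)

text \<open>Induction on the number of nonzero rows: a Schur complement step removes one of them and
  splits off a rank-one term.\<close>
lemma psd_inner_nonneg:
  assumes S: "psd S" and "psd Z"
  shows "0 \<le> S \<bullet> Z"
  using \<open>psd Z\<close>
proof (induction "card {k. Z $ k \<noteq> 0}" arbitrary: Z rule: less_induct)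
  case less
  show ?case
  proof (cases "Z = 0")
    case False
    then obtain k where k: "Z $ k \<noteq> 0"
      by (auto simp: vec_eq_iff)
    define e :: "real^'a" where "e = axis k 1"
    define w where "w = Z *v e"
    define c where "c = e \<bullet> w"
    have Zt: "transpose Z = Z"
      using less.prems by (simp add: psd_iff)
    have sw: "Z $ i $ j = Z $ j $ i" for i j
      by (subst (2) Zt[symmetric]) (simp add: transpose_def)
    have w: "w $ i = Z $ i $ k" for i
      by (simp add: w_def e_def matrix_vector_mult_basis column_def)
    have ww: "w = Z $ k"
      using w sw by (simp add: vec_eq_iff)
    \<comment> \<open>A zero pivot would make \<open>Z *v e\<close> vanish, but that vector is the
      nonzero row \<open>k\<close>.\<close>
    have "c \<noteq> 0"
      using psd_mult_eq_0[OF less.prems, of e] k ww by (auto simp: c_def w_def)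
    moreover have "0 \<le> c"
      using less.prems by (simp add: c_def w_def psd_iff)
    ultimately have c: "0 < c" by simp
    define Z' where "Z' = Z - (1 / c) *\<^sub>R outer w w"
    have ck: "c = w $ k"
      by (simp add: c_def e_def inner_axis' )
    have "psd Z'"
      unfolding psd_iff
    proof (intro conjI allI)
      show "transpose Z' = Z'"
        using sw by (simp add: Z'_def outer_def transpose_def vec_eq_iff)
      fix v
      \<comment> \<open>Cauchy-Schwarz against \<open>e\<close> is exactly semidefiniteness of the
        Schur complement.\<close>
      have "(v \<bullet> w)\<^sup>2 \<le> c * (v \<bullet> (Z *v v))"
        using psd_cauchy_schwarz[OF less.prems, of v e] by (simp add: c_def w_def mult.commute)
      then have "(v \<bullet> w)\<^sup>2 / c \<le> v \<bullet> (Z *v v)"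
        using c by (simp add: divide_le_eq mult.commute)
      moreover have "v \<bullet> (Z' *v v) = v \<bullet> (Z *v v) - (v \<bullet> w)\<^sup>2 / c"
        by (simp add: Z'_def matrix_vector_mult_diff_rdistrib scaleR_matrix_vector_assoc[symmetric]
            outer_mult_vec inner_diff_right power2_eq_square inner_commute)
      ultimately show "0 \<le> v \<bullet> (Z' *v v)" by simp
    qed
    moreover have "{i. Z' $ i \<noteq> 0} \<subset> {i. Z $ i \<noteq> 0}"
    proof
      have "Z' $ i = 0" if "Z $ i = 0" for i
        using that by (simp add: Z'_def outer_def vec_eq_iff w)
      then show "{i. Z' $ i \<noteq> 0} \<subseteq> {i. Z $ i \<noteq> 0}"
        by auto
      have "Z' $ k = 0"
        using c ck ww by (auto simp: Z'_def outer_def vec_eq_iff)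
      then show "{i. Z' $ i \<noteq> 0} \<noteq> {i. Z $ i \<noteq> 0}"
        using k by auto
    qed
    then have "card {i. Z' $ i \<noteq> 0} < card {i. Z $ i \<noteq> 0}"
      by (intro psubset_card_mono) auto
    ultimately have "0 \<le> S \<bullet> Z'"
      using less.hyps by blast
    moreover have "0 \<le> (1 / c) * (w \<bullet> (S *v w))"
      using S c by (simp add: psd_iff)
    moreover have "S \<bullet> Z = S \<bullet> Z' + (1 / c) * (w \<bullet> (S *v w))"
      by (simp add: Z'_def inner_diff_right inner_outer)
    ultimately show ?thesis by simp
  qed simp
qed

section \<open>Matrix algebra, congruences and Gram matrices\<close>

lemma bilinear_matrix_mult: "bilinear ((**) :: real^'b^'a \<Rightarrow> real^'c^'b \<Rightarrow> real^'c^'a)"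
  by (auto simp: bilinear_def linear_iff matrix_matrix_mult_def vec_eq_iff sum.distrib
      sum_distrib_left algebra_simps)

lemmas matrix_mult_add_left = bilinear_ladd[OF bilinear_matrix_mult]
  and matrix_mult_add_right = bilinear_radd[OF bilinear_matrix_mult]
  and matrix_mult_diff_left = bilinear_lsub[OF bilinear_matrix_mult]
  and matrix_mult_scaleR_left = bilinear_lmul[OF bilinear_matrix_mult]
  and matrix_mult_scaleR_right = bilinear_rmul[OF bilinear_matrix_mult]

lemma linear_transpose: "linear (transpose :: real^'b^'a \<Rightarrow> real^'a^'b)"
  by (rule linearI) (auto simp: transpose_def vec_eq_iff)

lemma linear_congruence: "linear (\<lambda>A :: real^'p^'p. Y ** A ** transpose Y)"
  by (rule linearI) (simp_all add: matrix_mult_add_left matrix_mult_add_right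
      matrix_mult_scaleR_left matrix_mult_scaleR_right)

lemma symm_nth: "X \<in> symm \<Longrightarrow> X $ i $ j = X $ j $ i"
  by (auto simp: symm_def transpose_def vec_eq_iff)

lemma congruence_symm: "A \<in> symm \<Longrightarrow> Y ** A ** transpose Y \<in> symm"
  by (simp add: symm_def matrix_transpose_mul matrix_mul_assoc)

lemma gram_symm: "Y ** transpose Y \<in> symm"
  by (simp add: symm_def matrix_transpose_mul)

declare transpose_matrix_vector [simp del]

lemma inner_matrix_vector:
  fixes A :: "real^'b^'a"
  shows "v \<bullet> (A *v w) = (transpose A *v v) \<bullet> w"
  by (simp add: dot_lmul_matrix transpose_matrix_vector)

lemma inner_congruence:
  fixes Y :: "real^'p^'n"
  shows "v \<bullet> ((Y ** A ** transpose Y) *v v) = (transpose Y *v v) \<bullet> (A *v (transpose Y *v v))"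
  by (simp add: inner_matrix_vector[of v Y] flip: matrix_vector_mul_assoc)

lemma inner_gram:
  fixes Y :: "real^'p^'n"
  shows "v \<bullet> ((Y ** transpose Y) *v v) = (transpose Y *v v) \<bullet> (transpose Y *v v)"
  by (simp add: inner_matrix_vector[of v Y] flip: matrix_vector_mul_assoc)

lemma gram_mult_eq_0_iff:
  fixes Y :: "real^'p^'n"
  shows "(Y ** transpose Y) *v v = 0 \<longleftrightarrow> transpose Y *v v = 0"
  using inner_gram[of v Y] by (auto simp flip: matrix_vector_mul_assoc)

text \<open>Full column rank makes \<open>transpose Y\<close> surjective, so
  \<open>Y ** transpose Y\<close> and \<open>Y\<close> have the same range.\<close>

lemma rank_gram:
  fixes Y :: "real^'p^'n"
  assumes "inj ((*v) Y)"
  shows "rank (Y ** transpose Y) = CARD('p)"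
proof -
  have rank: "rank Y = CARD('p)"
    using assms by (simp add: full_rank_injective)
  then have "range ((*v) (transpose Y)) = UNIV"
    by (simp add: rank_transpose flip: full_rank_surjective)
  then have "range ((*v) (Y ** transpose Y)) = range ((*v) Y)"
    by (simp add: image_image[symmetric] flip: matrix_vector_mul_assoc)
  with rank show ?thesis
    by (simp add: rank_dim_range)
qed

section \<open>The feasible set and its diagonal-block constraints\<close>

lemma feasible_iff:
  "X \<in> feasible \<longleftrightarrow> psd X \<and> (\<forall>i a b. X $ (i, a) $ (i, b) = (if a = b then 1 else 0))"
  by (simp add: feasible_def block_def mat_def vec_eq_iff)

lemma feasible_symm: "X \<in> feasible \<Longrightarrow> X \<in> symm"
  by (simp add: feasible_def psd_def)

lemma gram_feasible:
  assumes "Y \<in> stiefel"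
  shows "Y ** transpose Y \<in> feasible"
proof -
  have "block (Y ** transpose Y) i i = slice Y i ** transpose (slice Y i)" for i
    by (simp add: block_def slice_def matrix_matrix_mult_def transpose_def vec_eq_iff)
  moreover have "psd (Y ** transpose Y)"
    by (simp add: psd_def gram_symm inner_gram)
  ultimately show ?thesis
    using assms by (simp add: feasible_def stiefel_def)
qed

lemma symblockdiag_symm: "symblockdiag M \<in> symm"
  proof -
  have "symblockdiag M $ r $ s = symblockdiag M $ s $ r" for r s
    by (cases r; cases s) (auto simp: symblockdiag_nth add.commute)
  then show ?thesis
    by (simp add: symm_def transpose_def vec_eq_iff)
qed

lemma symblockdiag_eq_0_iff:
  assumes "M \<in> symm"
  shows "symblockdiag M = 0 \<longleftrightarrow> (\<forall>i a b. M $ (i, a) $ (i, b) = 0)"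
proof -
  have "symblockdiag M $ (i, a) $ (j, b) = (if i = j then M $ (i, a) $ (i, b) else 0)" for i a j b
    by (auto simp: symblockdiag_nth intro: symm_nth[OF assms])
  then show ?thesis
    by (auto simp: vec_eq_iff)
qed

lemma symblockdiag_diff_feasible:
  assumes "X \<in> feasible" "Z \<in> feasible"
  shows "symblockdiag (X - Z) = 0"
  using assms by (auto simp: feasible_iff symblockdiag_nth vec_eq_iff)

text \<open>The supports are complementary: \<open>symblockdiag M\<close> vanishes off the diagonal
  blocks, and \<open>D\<close> vanishes on them.\<close>

lemma inner_symblockdiag:
  assumes "D \<in> symm" "symblockdiag D = 0"
  shows "symblockdiag M \<bullet> D = 0"
proof -
  have "symblockdiag M $ r $ s * D $ r $ s = 0" for r s
    using assms symblockdiag_eq_0_iff[of D] by (cases r; cases s) (simp add: symblockdiag_nth)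
  then show ?thesis
    unfolding inner_vec_def by (intro sum.neutral ballI) simp
qed

lemma symm_combination:
  assumes "X \<in> symm" "Z \<in> symm"
  shows "a *\<^sub>R X + b *\<^sub>R Z \<in> symm"
  using assms by (intro subspace_add subspace_scale subspace_symm)

lemma convex_feasible: "convex feasible"
proof (rule convexI)
  fix X Z :: "('m::finite, 'd::finite) blockmat" and a b :: real
  assume "X \<in> feasible" "Z \<in> feasible" and ab: "0 \<le> a" "0 \<le> b" "a + b = 1"
  then show "a *\<^sub>R X + b *\<^sub>R Z \<in> feasible"
    by (auto simp: feasible_iff psd_def symm_combination matrix_vector_mult_add_rdistrib
        inner_add_right scaleR_matrix_vector_assoc[symmetric])
qed

section \<open>The face of a Gram matrix\<close>

text \<open>For symmetric \<open>X\<close> the kernel inclusion says that the range of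
  \<open>Z\<close> lies in that of \<open>X\<close>. This form avoids a choice of factorization and
  reduces the face property to vanishing quadratic forms.\<close>

definition kernel_face :: "('m::finite, 'd::finite) blockmat \<Rightarrow> ('m, 'd) blockmat set" where
  "kernel_face X = {Z \<in> feasible. \<forall>v. X *v v = 0 \<longrightarrow> Z *v v = 0}"

text \<open>On a kernel vector of \<open>X\<close> the form of \<open>Z\<close> is 0 and is a
  positive combination of the nonnegative forms of the endpoints, so both of these vanish, and
  semidefiniteness puts the vector into both kernels.\<close>

lemma kernel_face_face_of: "kernel_face X face_of feasible"
  unfolding face_of_def
proof (intro conjI ballI impI)
  show "kernel_face X \<subseteq> feasible"
    by (auto simp: kernel_face_def)
  show "convex (kernel_face X)"
    using convex_feasible
    by (auto simp: convex_def kernel_face_def matrix_vector_mult_add_rdistrib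
        scaleR_matrix_vector_assoc[symmetric])
  fix A B Z
  assume A: "A \<in> feasible" and B: "B \<in> feasible" and Z: "Z \<in> kernel_face X"
    and "Z \<in> open_segment A B"
  then obtain t where t: "0 < t" "t < 1" and Zt: "Z = (1 - t) *\<^sub>R A + t *\<^sub>R B"
    by (auto simp: in_segment)
  have "A *v v = 0 \<and> B *v v = 0" if "X *v v = 0" for v
  proof -
    have psd: "psd A" "psd B"
      using A B by (auto simp: feasible_def)
    then have nn: "0 \<le> (1 - t) * (v \<bullet> (A *v v))" "0 \<le> t * (v \<bullet> (B *v v))"
      using t by (auto simp: psd_def)
    have "v \<bullet> (Z *v v) = 0"
      using Z that by (simp add: kernel_face_def)
    then have "(1 - t) * (v \<bullet> (A *v v)) + t * (v \<bullet> (B *v v)) = 0"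
      by (simp add: Zt matrix_vector_mult_add_rdistrib inner_add_right
          scaleR_matrix_vector_assoc[symmetric])
    with nn have "(1 - t) * (v \<bullet> (A *v v)) = 0" "t * (v \<bullet> (B *v v)) = 0"
      by linarith+
    with t psd show ?thesis
      by (auto intro: psd_mult_eq_0)
  qed
  with A B show "A \<in> kernel_face X" "B \<in> kernel_face X"
    by (auto simp: kernel_face_def)
qed

text \<open>The vector \<open>v - transpose L *v (transpose Y *v v)\<close> is killed by
  \<open>transpose Y\<close>, hence by \<open>D\<close>, so
  \<open>D = D ** transpose L ** transpose Y\<close>. Transposing gives
  \<open>D = Y ** L ** D\<close>, and the two identities combine.\<close>

lemma congruence_factorization:
  fixes Y :: "real^'p^'n"
  assumes L: "L ** Y = mat 1" and D: "D \<in> symm"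
    and ker: "\<And>v. transpose Y *v v = 0 \<Longrightarrow> D *v v = 0"
  shows "D = Y ** (L ** D ** transpose L) ** transpose Y"
proof -
  have LY: "transpose Y ** transpose L = mat 1"
    by (simp add: L transpose_mat flip: matrix_transpose_mul)
  have LYv: "transpose Y *v (transpose L *v w) = w" for w
    by (simp add: matrix_vector_mul_assoc LY)
  have "D *v v = (D ** transpose L ** transpose Y) *v v" for v
  proof -
    have "transpose Y *v (v - transpose L *v (transpose Y *v v)) = 0"
      by (simp add: matrix_vector_mult_diff_distrib LYv)
    from ker[OF this] show ?thesis
      by (simp add: matrix_vector_mult_diff_distrib flip: matrix_vector_mul_assoc)
  qed
  then have 1: "D = D ** transpose L ** transpose Y"
    by (simp add: matrix_eq)
  moreover from D have 2: "transpose D = D"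
    by (simp add: symm_def)
  ultimately have "D = Y ** L ** D"
    by (metis matrix_mul_assoc matrix_transpose_mul transpose_transpose)
  with 1 show ?thesis
    by (metis matrix_mul_assoc)
qed

text \<open>Both forms depend on \<open>v\<close> only through \<open>w = transpose Y *v v\<close>,
  where the Gram form is \<open>w \<bullet> w\<close> and the perturbation is at most
  \<open>c * (w \<bullet> w)\<close> in absolute value; hence \<open>t = 1 / c\<close>.\<close>

lemma psd_gram_perturbation:
  fixes Y :: "real^'p^'n"
  assumes "Y ** B ** transpose Y \<in> symm"
  obtains t where "0 < t" "psd (Y ** transpose Y + t *\<^sub>R (Y ** B ** transpose Y))"
proof -
  obtain c where c: "0 < c" "\<And>w. norm (B *v w) \<le> c * norm w"
    using linear_bounded_pos[OF matrix_vector_mul_linear[of B]] by blast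
  define t where "t = 1 / c"
  have t: "0 < t" "t * c = 1"
    using c by (auto simp: t_def)
  have "psd (Y ** transpose Y + t *\<^sub>R (Y ** B ** transpose Y))"
    unfolding psd_def
  proof (intro conjI allI)
    show "Y ** transpose Y + t *\<^sub>R (Y ** B ** transpose Y) \<in> symm"
      using symm_combination[OF gram_symm assms, of 1] by simp
    fix v
    define w where "w = transpose Y *v v"
    have "\<bar>w \<bullet> (B *v w)\<bar> \<le> norm w * norm (B *v w)"
      by (rule Cauchy_Schwarz_ineq2)
    also have "\<dots> \<le> norm w * (c * norm w)"
      using c(2) by (intro mult_left_mono) auto
    also have "\<dots> = c * (w \<bullet> w)"
      by (simp add: dot_square_norm power2_eq_square)
    finally have "t * \<bar>w \<bullet> (B *v w)\<bar> \<le> t * (c * (w \<bullet> w))"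
      using t by (intro mult_left_mono) auto
    then have "t * \<bar>w \<bullet> (B *v w)\<bar> \<le> w \<bullet> w"
      using t by (simp flip: mult.assoc)
    moreover have "- (t * \<bar>w \<bullet> (B *v w)\<bar>) \<le> t * (w \<bullet> (B *v w))"
      using mult_left_mono[of "- \<bar>w \<bullet> (B *v w)\<bar>" "w \<bullet> (B *v w)" t] t by simp
    ultimately have "0 \<le> w \<bullet> w + t * (w \<bullet> (B *v w))"
      by linarith
    then show "0 \<le> v \<bullet> ((Y ** transpose Y + t *\<^sub>R (Y ** B ** transpose Y)) *v v)"
      by (simp add: w_def matrix_vector_mult_add_rdistrib inner_add_right
          scaleR_matrix_vector_assoc[symmetric] inner_gram inner_congruence)
  qed
  with t show thesis
    using that by blast
qed

text \<open>Used twice: to place the Gram matrix in the relative interior of the face, and to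
  realize the face directions.\<close>

lemma kernel_face_perturbation:
  fixes Y :: "('m::finite, 'd::finite, 'p::finite) slicemat"
  assumes Y: "Y \<in> stiefel" and D: "D = Y ** B ** transpose Y" "D \<in> symm" "symblockdiag D = 0"
  obtains t where "0 < t" "Y ** transpose Y + t *\<^sub>R D \<in> kernel_face (Y ** transpose Y)"
proof -
  obtain t where t: "0 < t" "psd (Y ** transpose Y + t *\<^sub>R D)"
    using psd_gram_perturbation[of Y B] D by metis
  have "Y ** transpose Y + t *\<^sub>R D \<in> feasible"
    using t gram_feasible[OF Y] D symblockdiag_eq_0_iff[of D] by (simp add: feasible_iff)
  moreover have "(Y ** transpose Y + t *\<^sub>R D) *v v = 0" if "(Y ** transpose Y) *v v = 0" for v
  proof -
    have "D *v v = Y *v (B *v (transpose Y *v v))"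
      by (simp add: D(1) flip: matrix_vector_mul_assoc)
    also have "\<dots> = 0"
      using that by (simp add: gram_mult_eq_0_iff)
    finally show ?thesis
      using that by (simp add: matrix_vector_mult_add_rdistrib scaleR_matrix_vector_assoc[symmetric])
  qed
  ultimately show thesis
    using that t by (auto simp: kernel_face_def)
qed

text \<open>A converse to the perturbation lemma: \<open>Y ** transpose Y\<close> and
  \<open>transpose Y\<close> have the same kernel, so the difference is killed there and factors
  through a left inverse of \<open>Y\<close>.\<close>

lemma kernel_face_factorization:
  fixes Y :: "('m::finite, 'd::finite, 'p::finite) slicemat"
  assumes "Y \<in> stiefel" and "inj ((*v) Y)" and "Z \<in> kernel_face (Y ** transpose Y)"
  obtains B where "Y ** transpose Y - Z = Y ** B ** transpose Y" "Y ** transpose Y - Z \<in> symm"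
    "symblockdiag (Y ** transpose Y - Z) = 0"
proof -
  let ?D = "Y ** transpose Y - Z"
  have Z: "Z \<in> feasible" "\<And>v. transpose Y *v v = 0 \<Longrightarrow> Z *v v = 0"
    using assms by (auto simp: kernel_face_def gram_mult_eq_0_iff)
  have D: "?D \<in> symm"
    by (intro subspace_diff subspace_symm gram_symm feasible_symm Z)
  obtain L where L: "L ** Y = mat 1"
    using assms matrix_left_invertible_injective by blast
  have "?D = Y ** (L ** ?D ** transpose L) ** transpose Y"
    using Z by (intro congruence_factorization L D)
      (simp add: matrix_vector_mult_diff_rdistrib gram_mult_eq_0_iff)
  then show thesis
    using D symblockdiag_diff_feasible[OF gram_feasible Z(1)] assms(1) that by blast
qed

text \<open>Every segment from a point \<open>Z\<close> of the face to \<open>?X\<close> extends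
  beyond \<open>?X\<close>, because \<open>?X - Z\<close> is an admissible perturbation; so
  \<open>?X\<close> is a relative interior point. Faces whose relative interiors meet are equal,
  which gives uniqueness.\<close>

lemma face_at_gram:
  fixes Y :: "('m::finite, 'd::finite, 'p::finite) slicemat"
  assumes Y: "Y \<in> stiefel" and inj: "inj ((*v) Y)"
  shows "face_at (Y ** transpose Y) = kernel_face (Y ** transpose Y)"
proof -
  let ?X = "Y ** transpose Y"
  let ?F = "kernel_face ?X"
  have X: "?X \<in> ?F"
    using gram_feasible[OF Y] by (simp add: kernel_face_def)
  have "?X \<in> rel_interior ?F"
  proof (subst convex_rel_interior_iff)
    show "convex ?F"
      using kernel_face_face_of face_of_imp_convex by blast
    show "\<forall>Z\<in>?F. \<exists>e>1. (1 - e) *\<^sub>R Z + e *\<^sub>R ?X \<in> ?F"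
    proof
      fix Z assume "Z \<in> ?F"
      then obtain t where t: "0 < t" "?X + t *\<^sub>R (?X - Z) \<in> ?F"
        by (metis kernel_face_factorization[OF Y inj] kernel_face_perturbation[OF Y])
      have "?X + t *\<^sub>R (?X - Z) = (1 - (1 + t)) *\<^sub>R Z + (1 + t) *\<^sub>R ?X"
        by (simp add: algebra_simps)
      with t show "\<exists>e>1. (1 - e) *\<^sub>R Z + e *\<^sub>R ?X \<in> ?F"
        by (intro exI[of _ "1 + t"]) simp
    qed
  qed (use X in auto)
  then show ?thesis
    unfolding face_at_def using kernel_face_face_of
    by (intro the_equality) (blast, metis IntI empty_iff face_of_eq)
qed

section \<open>The dimension of the face\<close>

text \<open>For symmetric \<open>A\<close> the condition amounts to \<open>Y_i A Y_i^T = 0\<close>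
  for every slice, the linear system in the explicit description of the face.\<close>

definition face_directions :: "('m::finite, 'd::finite, 'p::finite) slicemat \<Rightarrow> (real^'p^'p) set" where
  "face_directions Y = {A \<in> symm. symblockdiag (Y ** A ** transpose Y) = 0}"

text \<open>The congruence by \<open>Y\<close> is injective, being undone by the left inverse
  \<open>L\<close>, and maps face directions into the span of the face translated by
  \<open>- ?X\<close>.\<close>

lemma aff_dim_face_at_ge:
  fixes Y :: "('m::finite, 'd::finite, 'p::finite) slicemat"
  assumes Y: "Y \<in> stiefel" and inj: "inj ((*v) Y)"
  shows "int (dim (face_directions Y)) \<le> aff_dim (face_at (Y ** transpose Y))"
proof -
  let ?X = "Y ** transpose Y"
  let ?F = "kernel_face ?X"
  let ?g = "\<lambda>A. Y ** A ** transpose Y"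
  obtain L where L: "L ** Y = mat 1"
    using inj matrix_left_invertible_injective by blast
  have LY: "transpose Y ** transpose L = mat 1"
    by (simp add: L transpose_mat flip: matrix_transpose_mul)
  have "L ** ?g A ** transpose L = A" for A
  proof -
    have "L ** ?g A ** transpose L = (L ** Y) ** A ** (transpose Y ** transpose L)"
      by (simp only: matrix_mul_assoc)
    then show ?thesis by (simp add: L LY)
  qed
  then have "inj ?g"
    by (rule inj_on_inverseI)
  then have "dim (face_directions Y) = dim (?g ` face_directions Y)"
    by (intro dim_image_eq[OF linear_congruence, symmetric]) (auto intro: inj_on_subset)
  also have "\<dots> \<le> dim ((+) (- ?X) ` ?F)"
  proof (rule dim_mono, safe)
    fix A assume "A \<in> face_directions Y"
    then obtain t where t: "0 < t" "?X + t *\<^sub>R ?g A \<in> ?F"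
      using kernel_face_perturbation[OF Y, of "?g A" A] congruence_symm
      by (auto simp: face_directions_def)
    \<comment> \<open>Only this multiple of the direction is known to stay in the translated face;
      the span absorbs the factor.\<close>
    have "t *\<^sub>R ?g A \<in> (+) (- ?X) ` ?F"
      using t(2) by force
    then have "(1 / t) *\<^sub>R t *\<^sub>R ?g A \<in> span ((+) (- ?X) ` ?F)"
      by (intro span_scale span_base)
    with t(1) show "?g A \<in> span ((+) (- ?X) ` ?F)"
      by simp
  qed
  also have "int \<dots> = aff_dim ?F"
    using gram_feasible[OF Y]
    by (intro aff_dim_eq_dim[symmetric] hull_inc) (simp add: kernel_face_def)
  finally show ?thesis
    by (simp add: face_at_gram[OF Y inj])
qed

lemma tangent_iff: "V \<in> tangent Y \<longleftrightarrow> symblockdiag (V ** transpose Y + Y ** transpose V) = 0"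
  by (simp add: tangent_def)

text \<open>Rank-nullity for the tangency map \<open>\<Phi>\<close> on \<open>W\<close>: the source
  has dimension at least \<open>p + p (p + 1) / 2\<close>, the image at most
  \<open>m d (d + 1) / 2\<close>, and the assumption forces the kernel into the face directions. The
  free vector \<open>z\<close> supplies the summand \<open>p\<close>.\<close>

lemma dim_face_directions_ge:
  fixes Y :: "('m::finite, 'd::finite, 'p::finite) slicemat"
  assumes "\<And>z A. A \<in> symm \<Longrightarrow> outer u z + Y ** A \<in> tangent Y \<Longrightarrow> z = 0"
  shows "Delta CARD('m) CARD('d) CARD('p) + real CARD('p) \<le> real (dim (face_directions Y))"
proof -
  define h :: "(real^'p) \<times> (real^'p^'p) \<Rightarrow> ('m, 'd, 'p) slicemat"
    where "h = (\<lambda>x. outer u (fst x) + Y ** snd x)"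
  define \<Phi> where "\<Phi> = (\<lambda>x. symblockdiag (h x ** transpose Y + Y ** transpose (h x)))"
  define W where "W = (UNIV :: (real^'p) set) \<times> (symm :: (real^'p^'p) set)"
  have h: "linear h"
    by (rule linearI) (simp_all add: h_def outer_def vec_eq_iff matrix_mult_add_right
        matrix_mult_scaleR_right algebra_simps)
  have "linear (\<lambda>V. symblockdiag (V ** transpose Y + Y ** transpose V))"
    by (rule linearI) (simp_all add: linear_add[OF linear_symblockdiag, symmetric]
        linear_scale[OF linear_symblockdiag, symmetric] linear_add[OF linear_transpose] transpose_scalar
        matrix_mult_add_left matrix_mult_add_right matrix_mult_scaleR_left matrix_mult_scaleR_right
        algebra_simps)
  from linear_compose[OF h this] have \<Phi>: "linear \<Phi>"
    by (simp add: \<Phi>_def o_def)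
  have W: "subspace W"
    unfolding W_def by (intro subspace_Times subspace_UNIV subspace_symm)
  have "{x \<in> W. \<Phi> x = 0} \<subseteq> Pair 0 ` face_directions Y"
  proof safe
    fix z :: "real^'p" and A assume zA: "(z, A) \<in> W" "\<Phi> (z, A) = 0"
    then have A: "A \<in> symm"
      by (simp add: W_def)
    moreover have "outer u z + Y ** A \<in> tangent Y"
      using zA by (simp add: tangent_iff \<Phi>_def h_def)
    ultimately have z: "z = 0"
      by (rule assms)
    \<comment> \<open>For \<open>z = 0\<close> the two summands of the tangency condition coincide,
      as \<open>A\<close> is symmetric.\<close>
    have "\<Phi> (0, A) = 2 *\<^sub>R symblockdiag (Y ** A ** transpose Y)"
      using A by (simp add: \<Phi>_def h_def outer_def symm_def matrix_transpose_mul matrix_mul_assoc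
          linear_add[OF linear_symblockdiag] scaleR_2 flip: zero_vec_def)
    with zA z A have "A \<in> face_directions Y"
      by (simp add: face_directions_def)
    with z show "(z, A) \<in> Pair 0 ` face_directions Y"
      by blast
  qed
  then have "dim {x \<in> W. \<Phi> x = 0} \<le> dim (Pair (0 :: real^'p) ` face_directions Y)"
    by (rule dim_subset)
  also have "\<dots> \<le> dim (face_directions Y)"
    by (intro dim_image_le linearI) auto
  finally have "dim {x \<in> W. \<Phi> x = 0} \<le> dim (face_directions Y)" .
  moreover have "dim (\<Phi> ` W) \<le> dim (range (symblockdiag :: ('m, 'd) blockmat \<Rightarrow> _))"
    by (rule dim_subset) (auto simp: \<Phi>_def)
  moreover have "dim W = CARD('p) + dim (symm :: (real^'p^'p) set)"
    by (simp add: W_def dim_Times subspace_symm)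
  ultimately have "CARD('p) + dim (symm :: (real^'p^'p) set)
      \<le> dim (range (symblockdiag :: ('m, 'd) blockmat \<Rightarrow> _)) + dim (face_directions Y)"
    using dim_le_dim_image_plus_kernel[OF \<Phi> W] by linarith
  then have "2 * CARD('p) + CARD('p) * (CARD('p) + 1)
      \<le> CARD('m) * (CARD('d) * (CARD('d) + 1)) + 2 * dim (face_directions Y)"
    using dim_symm_ge[where 'n = 'p] dim_symblockdiag_le[where 'm = 'm and 'd = 'd] by linarith
  then have "real (2 * CARD('p) + CARD('p) * (CARD('p) + 1))
      \<le> real (CARD('m) * (CARD('d) * (CARD('d) + 1)) + 2 * dim (face_directions Y))"
    by (rule of_nat_mono)
  then show ?thesis
    by (simp add: Delta_def field_simps)
qed

section \<open>The dual certificate and the second-order condition\<close>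

text \<open>The dual slack matrix, with \<open>symblockdiag (C ** X)\<close> as Lagrange multiplier
  for the diagonal-block constraints.\<close>

definition certificate :: "('m::finite, 'd::finite) blockmat \<Rightarrow> ('m, 'd) blockmat \<Rightarrow> ('m, 'd) blockmat" where
  "certificate C X = C - symblockdiag (C ** X)"

lemma certificate_symm: "C \<in> symm \<Longrightarrow> certificate C X \<in> symm"
  unfolding certificate_def by (intro subspace_diff subspace_symm symblockdiag_symm)

text \<open>Feasible points share their diagonal blocks, so the multiplier is orthogonal to their
  difference.\<close>

lemma inner_certificate:
  assumes "Z \<in> feasible" "Z' \<in> feasible"
  shows "certificate C X \<bullet> (Z - Z') = C \<bullet> (Z - Z')"
proof -
  have "Z - Z' \<in> symm"
    by (intro subspace_diff subspace_symm feasible_symm assms)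
  then have "symblockdiag (C ** X) \<bullet> (Z - Z') = 0"
    using symblockdiag_diff_feasible[OF assms] by (rule inner_symblockdiag)
  then show ?thesis
    by (simp add: certificate_def inner_diff_left)
qed

text \<open>For linear \<open>f\<close> the Hessian term of \<open>f\<close> is zero, and what
  remains of the Riemannian Hessian is twice the certificate applied to \<open>V\<close>.\<close>

lemma second_order_critical_point_linearD:
  assumes f: "linear_on_symm f" and crit: "second_order_critical_point f Y"
    and C: "\<And>X. X \<in> symm \<Longrightarrow> grad f X = C"
  shows "Y \<in> stiefel" "certificate C (Y ** transpose Y) ** Y = 0"
    "\<And>V. V \<in> tangent Y \<Longrightarrow> 0 \<le> V \<bullet> (certificate C (Y ** transpose Y) ** V)"
proof -
  have C: "grad f (Y ** transpose Y) = C"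
    by (rule C[OF gram_symm])
  show "Y \<in> stiefel" "certificate C (Y ** transpose Y) ** Y = 0"
    using crit by (simp_all add: second_order_critical_point_def critical_point_def Let_def C
        certificate_def)
  fix V assume V: "V \<in> tangent Y"
  \<comment> \<open>The Hessian of \<open>f\<close> is meaningful in symmetric directions
    only.\<close>
  have symm: "V ** transpose Y + Y ** transpose V \<in> symm"
    by (simp add: symm_def linear_add[OF linear_transpose] matrix_transpose_mul add.commute)
  have "hess_g f Y V - symblockdiag (grad_g f Y ** transpose Y) ** V
      = 2 *\<^sub>R (certificate C (Y ** transpose Y) ** V)"
    by (simp add: hess_g_def grad_g_def linear_on_symm_hess[OF f gram_symm symm] C certificate_def
        matrix_mult_diff_left matrix_mult_scaleR_left linear_scale[OF linear_symblockdiag]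
        bilinear_lzero[OF bilinear_matrix_mult] scaleR_diff_right flip: matrix_mul_assoc)
  then show "0 \<le> V \<bullet> (certificate C (Y ** transpose Y) ** V)"
    using crit V by (auto simp: second_order_critical_point_def frob_eq_inner)
qed

lemma symm_mult_eq_0:
  assumes "S \<in> symm" "S ** Y = 0"
  shows "transpose Y ** S = 0"
proof -
  have "transpose Y ** S = transpose (S ** Y)"
    using assms(1) by (simp add: matrix_transpose_mul symm_def)
  then show ?thesis
    by (simp add: assms(2) linear_0[OF linear_transpose])
qed

text \<open>Since \<open>S Y = 0\<close>, the component \<open>Y A\<close> does not contribute.\<close>
lemma inner_outer_plus:
  assumes S: "S \<in> symm" "S ** Y = 0" and V: "V = outer u z + Y ** A"
  shows "V \<bullet> (S ** V) = (z \<bullet> z) * (u \<bullet> (S *v u))"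
proof -
  have SV: "S ** V = outer (S *v u) z"
    by (simp add: V matrix_mult_add_right mult_outer matrix_mul_assoc S
        bilinear_lzero[OF bilinear_matrix_mult])
  have "transpose Y *v (S *v u) = 0"
    by (simp add: matrix_vector_mul_assoc symm_mult_eq_0[OF S])
  then have "(Y ** A) \<bullet> outer (S *v u) z = 0"
    by (simp add: inner_matrix_mult_left mult_outer)
  moreover have "outer u z \<bullet> outer (S *v u) z = (z \<bullet> z) * (u \<bullet> (S *v u))"
    by (simp add: inner_outer outer_mult_vec inner_commute)
  ultimately show ?thesis
    unfolding SV by (simp add: V inner_add_left)
qed

theorem corollary3p14:
  fixes f :: "real^('m::finite \<times> 'd::finite)^('m \<times> 'd) \<Rightarrow> real"
    and Y :: "real^('p::finite)^('m \<times> 'd)"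
  assumes "CARD('d) \<le> CARD('p)" and "CARD('p) \<le> CARD('m) * CARD('d)"
    and "linear_on_symm f"
    and "real CARD('p) > pstar CARD('m) CARD('d)"
    and "second_order_critical_point f Y"
    and "\<not> global_optimizer f (Y ** transpose Y)"
  shows "rank (Y ** transpose Y) = CARD('p)
    \<and> real_of_int (aff_dim (face_at (Y ** transpose Y)))
        \<ge> Delta CARD('m) CARD('d) CARD('p) + real CARD('p)
    \<and> f constant_on face_at (Y ** transpose Y)"
proof -
  let ?X = "Y ** transpose Y"
  obtain C where C: "C \<in> symm" "\<And>X. X \<in> symm \<Longrightarrow> f X = C \<bullet> X" "\<And>X. X \<in> symm \<Longrightarrow> grad f X = C"
    using linear_on_symm_grad[OF assms(3)] unfolding frob_eq_inner by blast
  define S where "S = certificate C ?X"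
  have Y: "Y \<in> stiefel" and SY: "S ** Y = 0"
    and second: "\<And>V. V \<in> tangent Y \<Longrightarrow> 0 \<le> V \<bullet> (S ** V)"
    using second_order_critical_point_linearD[OF assms(3,5) C(3)] by (auto simp: S_def)
  have S: "S \<in> symm"
    unfolding S_def by (rule certificate_symm[OF C(1)])
  have X: "?X \<in> feasible"
    by (rule gram_feasible[OF Y])
  have f_diff: "f Z - f ?X = S \<bullet> (Z - ?X)" if "Z \<in> feasible" for Z
    using inner_certificate[OF that X, of C ?X] C(2) that X
    by (simp add: S_def feasible_symm inner_diff_right)
  have YS: "transpose Y ** S = 0"
    by (rule symm_mult_eq_0[OF S SY])
  \<comment> \<open>Complementary slackness, which serves for \<open>?X\<close> itself and for
    differences inside its face.\<close>
  have S_orth: "S \<bullet> (Y ** B) = 0" for B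
    by (simp add: inner_commute[of S] inner_matrix_mult_left YS)

  have "\<not> psd S"
  proof
    assume "psd S"
    have "f ?X \<le> f Z" if "Z \<in> feasible" for Z
    proof -
      \<comment> \<open>Weak duality: \<open>S \<bullet> Z\<close> is nonnegative, whereas
        \<open>S \<bullet> ?X\<close> is 0.\<close>
      have "0 \<le> S \<bullet> Z"
        using \<open>psd S\<close> that by (intro psd_inner_nonneg) (auto simp: feasible_def)
      then show ?thesis
        using f_diff[OF that] S_orth by (simp add: inner_diff_right)
    qed
    with X assms(6) show False
      by (simp add: global_optimizer_def)
  qed
  then obtain u where u: "u \<bullet> (S *v u) < 0"
    using S by (auto simp: psd_def not_le)
  have z0: "z = 0" if "outer u z + Y ** A \<in> tangent Y" for z A
  proof (rule ccontr)
    assume "z \<noteq> 0"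
    then have "(z \<bullet> z) * (u \<bullet> (S *v u)) < 0"
      using u by (simp add: mult_pos_neg)
    then show False
      using second[OF that] inner_outer_plus[OF S SY refl, of u z A] by simp
  qed

  have "z = 0" if "Y *v z = 0" for z
  proof (rule z0)
    \<comment> \<open>Each product is an outer product with the factor
      \<open>Y *v z\<close>.\<close>
    have "outer u z ** transpose Y = 0" "Y ** transpose (outer u z) = 0"
      using that by (simp_all add: outer_mult transpose_outer mult_outer)
        (simp add: outer_def vec_eq_iff)
    then show "outer u z + Y ** 0 \<in> tangent Y"
      by (simp add: tangent_iff bilinear_rzero[OF bilinear_matrix_mult] linear_0[OF linear_symblockdiag])
  qed
  then have inj: "inj ((*v) Y)"
    by (simp add: vec.inj_iff_eq_0)
  have "f constant_on face_at ?X"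
    unfolding constant_on_def
  proof (intro exI ballI)
    fix Z assume "Z \<in> face_at ?X"
    then have Z: "Z \<in> kernel_face ?X"
      by (simp add: face_at_gram[OF Y inj])
    then obtain B where B: "?X - Z = Y ** B ** transpose Y"
      using kernel_face_factorization[OF Y inj] by blast
    \<comment> \<open>Regrouped as \<open>Y ** (B ** transpose Y)\<close>, the difference is
      orthogonal to \<open>S\<close>.\<close>
    have "S \<bullet> (?X - Z) = 0"
      unfolding B matrix_mul_assoc[symmetric] by (rule S_orth)
    then show "f Z = f ?X"
      using f_diff[of Z] Z by (simp add: kernel_face_def inner_diff_right)
  qed
  moreover have "Delta CARD('m) CARD('d) CARD('p) + real CARD('p) \<le> real (dim (face_directions Y))"
    by (rule dim_face_directions_ge) (rule z0)
  then have "Delta CARD('m) CARD('d) CARD('p) + real CARD('p)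
      \<le> real_of_int (aff_dim (face_at ?X))"
    using aff_dim_face_at_ge[OF Y inj] by linarith
  ultimately show ?thesis
    using rank_gram[OF inj] by simp
qed

end
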